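(* Let $(\mathbb{R}^{3},g_{Nil})$ denote Nil space, where the metric with respect to the standard coordinates $(x,y,z)$ in $\mathbb{R}^{3}$ is given by $g_{Nil}={\rm d}x^{2}+{\rm d}y^{2}+({\rm d}z-x\,{\rm d}y)^{2}$. Then: (1) A linear function $f:(\mathbb{R}^{3},g_{Nil})\to\mathbb{R}$, $f(x,y,z)=Ax+By+Cz$, is an $\infty$-harmonic function if and only if $A=0$ or $C=0$. (2) A linear map $\varphi:(\mathbb{R}^{3},g_{Nil})\to\mathbb{R}^{n}$ ($n\ge 2$) is $\infty$-harmonic if and only if $\varphi$ is a composition of the projection $\pi_{1}:(\mathbb{R}^{3},g_{Nil})\to\mathbb{R}^{2}$, $\pi_{1}(x,y,z)=(x,y)$, followed by a linear map $\mathbb{R}^{2}\to\mathbb{R}^{n}$, or $\varphi$ is a composition of the projection $\pi_{2}:(\mathbb{R}^{3},g_{Nil})\to\mathbb{R}^{2}$, $\pi_{2}(x,y,z)=(y,z)$, followed by a linear map $\mathbb{R}^{2}\to\mathbb{R}^{n}$.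
   Context: A smooth map $\varphi:(M,g)\to(N,h)$ between Riemannian manifolds is called $\infty$-harmonic if $\tfrac12\,{\rm d}\varphi({\rm grad}\,|{\rm d}\varphi|^2)=0$ on $M$, where $|{\rm d}\varphi|^2={\rm Trace}_g\,\varphi^*h$ is the energy density of $\varphi$ and the gradient is taken with respect to $g$. A function $f:(M,g)\to\mathbb{R}$ is an $\infty$-harmonic function if $\Delta_\infty f=\tfrac12 g(\nabla f,\nabla|\nabla f|^2)=0$, i.e. if it is $\infty$-harmonic as a map into $\mathbb{R}$. Here $A,B,C$ are real constants, and $\mathbb{R}$ and $\mathbb{R}^n$ as targets carry the standard Euclidean metric. *)

theory Defs
  imports "HOL-Analysis.Analysis"
begin

text \<open>Continuous differentiability of order k on a whole normed space. In finite dimension,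
  continuity of all iterated directional derivatives is the usual notion of class C^k.\<close>

primrec k_smooth :: "nat \<Rightarrow> ('a::real_normed_vector \<Rightarrow> 'b::real_normed_vector) \<Rightarrow> bool" where
  "k_smooth 0 f \<longleftrightarrow> continuous_on UNIV f"
| "k_smooth (Suc k) f \<longleftrightarrow>
     (\<forall>x. f differentiable (at x)) \<and> (\<forall>v. k_smooth k (\<lambda>x. frechet_derivative f (at x) v))"

definition smooth :: "('a::real_normed_vector \<Rightarrow> 'b::real_normed_vector) \<Rightarrow> bool" where
  "smooth f \<longleftrightarrow> (\<forall>k. k_smooth k f)"

text \<open>All manifolds are Euclidean spaces with one global chart, so each tangent space is the space
  itself. A metric \<open>g\<close> assigns to a point \<open>p\<close> the bilinear form \<open>g p\<close> on the tangent space at \<open>p\<close>.\<close>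

type_synonym 'a metric_field = "'a \<Rightarrow> 'a \<Rightarrow> 'a \<Rightarrow> real"

definition riemannian_metric :: "'a::euclidean_space metric_field \<Rightarrow> bool" where
  "riemannian_metric g \<longleftrightarrow>
     (\<forall>p. bilinear (g p) \<and> (\<forall>u v. g p u v = g p v u) \<and> (\<forall>v. v \<noteq> 0 \<longrightarrow> g p v v > 0)) \<and>
     (\<forall>u v. smooth (\<lambda>p. g p u v))"

definition standard_metric :: "'a::euclidean_space metric_field" where
  "standard_metric p u v = u \<bullet> v"

definition gradient :: "'a::euclidean_space metric_field \<Rightarrow> ('a \<Rightarrow> real) \<Rightarrow> 'a \<Rightarrow> 'a" where
  "gradient g f p = (THE w. \<forall>v. g p w v = frechet_derivative f (at p) v)"

definition gram_matrix :: "(real^'m) metric_field \<Rightarrow> real^'m \<Rightarrow> real^'m^'m" where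
  "gram_matrix g p = (\<chi> i j. g p (axis i 1) (axis j 1))"

text \<open>The trace with respect to \<open>g\<close> of a bilinear form \<open>b\<close>: the inverse metric coefficients
  contracted with the coefficients of \<open>b\<close>.\<close>

definition metric_trace ::
    "(real^'m) metric_field \<Rightarrow> real^'m \<Rightarrow> (real^'m \<Rightarrow> real^'m \<Rightarrow> real) \<Rightarrow> real" where
  "metric_trace g p b =
     (\<Sum>i\<in>UNIV. \<Sum>j\<in>UNIV. matrix_inv (gram_matrix g p) $ i $ j * b (axis i 1) (axis j 1))"

definition pullback_metric ::
    "('a::euclidean_space \<Rightarrow> 'b::euclidean_space) \<Rightarrow> 'b metric_field \<Rightarrow> 'a metric_field" where
  "pullback_metric \<phi> h p u v =
     h (\<phi> p) (frechet_derivative \<phi> (at p) u) (frechet_derivative \<phi> (at p) v)"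

definition energy_density ::
    "(real^'m) metric_field \<Rightarrow> 'b::euclidean_space metric_field \<Rightarrow> (real^'m \<Rightarrow> 'b) \<Rightarrow> real^'m \<Rightarrow> real"
where
  "energy_density g h \<phi> p = metric_trace g p (pullback_metric \<phi> h p)"

definition inf_harmonic_map ::
    "(real^'m) metric_field \<Rightarrow> 'b::euclidean_space metric_field \<Rightarrow> (real^'m \<Rightarrow> 'b) \<Rightarrow> bool" where
  "inf_harmonic_map g h \<phi> \<longleftrightarrow> smooth \<phi> \<and>
     (\<forall>p. (1/2) *\<^sub>R frechet_derivative \<phi> (at p) (gradient g (energy_density g h \<phi>) p) = 0)"

definition inf_laplacian :: "'a::euclidean_space metric_field \<Rightarrow> ('a \<Rightarrow> real) \<Rightarrow> 'a \<Rightarrow> real" where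
  "inf_laplacian g f p =
     1/2 * g p (gradient g f p) (gradient g (\<lambda>q. g q (gradient g f q) (gradient g f q)) p)"

definition inf_harmonic_function ::
    "'a::euclidean_space metric_field \<Rightarrow> ('a \<Rightarrow> real) \<Rightarrow> bool" where
  "inf_harmonic_function g f \<longleftrightarrow> smooth f \<and> (\<forall>p. inf_laplacian g f p = 0)"

text \<open>The coordinates (x, y, z) of a point \<open>p\<close> are \<open>p $ 1\<close>, \<open>p $ 2\<close>, \<open>p $ 3\<close>; the last summand is
  the symmetric square of the form dz - x dy.\<close>

definition nil_metric :: "(real^3) metric_field" where
  "nil_metric p u v =
     u $ 1 * v $ 1 + u $ 2 * v $ 2 + (u $ 3 - p $ 1 * u $ 2) * (v $ 3 - p $ 1 * v $ 2)"

definition proj_xy :: "real^3 \<Rightarrow> real^2" where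
  "proj_xy p = vector [p $ 1, p $ 2]"

definition proj_yz :: "real^3 \<Rightarrow> real^2" where
  "proj_yz p = vector [p $ 2, p $ 3]"

text \<open>The definite description in \<open>gradient\<close> is always met for a Riemannian metric and a
  differentiable function.\<close>

lemma gradient_unique_existence:
  fixes f :: "'a::euclidean_space \<Rightarrow> real"
  assumes g: "riemannian_metric g" and f: "f differentiable (at p)"
  shows "\<exists>!w. \<forall>v. g p w v = frechet_derivative f (at p) v"
proof -
  have bil: "bilinear (g p)" and pos: "\<And>v. v \<noteq> 0 \<Longrightarrow> g p v v > 0"
    using g by (auto simp: riemannian_metric_def)
  have lin_r: "linear (g p w)" and lin_l: "linear (\<lambda>w. g p w v)" for v w
    using bil by (auto simp: bilinear_def)
  have lin_df: "linear (frechet_derivative f (at p))"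
    by (rule linear_frechet_derivative[OF f])
  define T where "T w = (\<Sum>b\<in>Basis. g p w b *\<^sub>R b)" for w
  have expand: "l v = (\<Sum>b\<in>Basis. (v \<bullet> b) * l b)" if "linear l" for l :: "'a \<Rightarrow> real" and v
  proof -
    have "l v = l (\<Sum>b\<in>Basis. (v \<bullet> b) *\<^sub>R b)"
      by (simp only: euclidean_representation)
    then show ?thesis
      by (simp add: linear_sum[OF that] linear_scale[OF that])
  qed
  have lin_T: "linear T"
    by (rule linearI)
       (simp_all add: T_def linear_add[OF lin_l] linear_scale[OF lin_l] scaleR_add_left
          sum.distrib scaleR_sum_right)
  have T_inner: "T w \<bullet> b = g p w b" if "b \<in> Basis" for w b
    using that by (simp add: T_def inner_sum_left inner_Basis if_distrib cong: if_cong)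
  have zero: "w = 0" if "\<forall>v. g p w v = 0" for w
    using pos[of w] that by force
  have "inj T"
    unfolding linear_injective_0[OF lin_T]
  proof (intro allI impI)
    fix w assume "T w = 0"
    then have "g p w b = 0" if "b \<in> Basis" for b
      using T_inner[OF that, of w] by simp
    then have "g p w v = 0" for v
      by (subst expand[OF lin_r]) simp
    then have "\<forall>v. g p w v = 0" by blast
    then show "w = 0" by (rule zero)
  qed
  then have "surj T"
    using linear_injective_imp_surjective[OF lin_T] by blast
  then obtain w where w: "T w = (\<Sum>b\<in>Basis. frechet_derivative f (at p) b *\<^sub>R b)"
    by (metis surjD)
  have basis: "g p w b = frechet_derivative f (at p) b" if "b \<in> Basis" for b
    using T_inner[OF that, of w] that
    by (simp add: w inner_sum_left inner_Basis if_distrib cong: if_cong)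
  have ex: "\<forall>v. g p w v = frechet_derivative f (at p) v"
  proof
    fix v
    show "g p w v = frechet_derivative f (at p) v"
      by (subst expand[OF lin_r], subst expand[OF lin_df]) (simp add: basis)
  qed
  moreover have "w' = w" if "\<forall>v. g p w' v = frechet_derivative f (at p) v" for w'
    using zero[of "w' - w"] that ex by (simp add: linear_diff[OF lin_l])
  ultimately show ?thesis by blast
qed

lemma smooth_const: "smooth (\<lambda>x. c)"
proof -
  have "k_smooth k (\<lambda>x::'a. c)" for k and c :: "'b::real_normed_vector"
    by (induction k arbitrary: c) (auto simp: frechet_derivative_const)
  then show ?thesis by (simp add: smooth_def)
qed

lemma riemannian_metric_standard: "riemannian_metric standard_metric"
  by (auto simp: riemannian_metric_def standard_metric_def smooth_const inner_commute
      bilinear_def inner_add_left inner_add_right intro!: linearI)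

lemma riemannian_metric_nil: "riemannian_metric nil_metric"
proof -
  have k: "k_smooth k (\<lambda>p::real^3. a + b * p $ 1 + c * (p $ 1)\<^sup>2)" for k and a b c :: real
  proof (induction k arbitrary: a b c)
    case 0
    then show ?case by (auto intro!: continuous_intros)
  next
    case (Suc k)
    have D: "((\<lambda>p::real^3. a + b * p $ 1 + c * (p $ 1)\<^sup>2) has_derivative
              (\<lambda>v. b * v $ 1 + 2 * c * p $ 1 * v $ 1)) (at p)" for p
      by (auto intro!: derivative_eq_intros bounded_linear_imp_has_derivative
          bounded_linear_vec_nth simp: algebra_simps)
    have "k_smooth k (\<lambda>p::real^3. b * v $ 1 + 2 * c * p $ 1 * v $ 1)" for v :: "real^3"
      using Suc[of "b * v $ 1" "2 * c * v $ 1" 0] by (simp add: mult.assoc mult.commute mult.left_commute)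
    then show ?case
      using D by (auto simp: differentiable_def frechet_derivative_at[OF D, symmetric])
  qed
  have "smooth (\<lambda>p. nil_metric p u v)" for u v
  proof -
    have "(\<lambda>p. nil_metric p u v) =
        (\<lambda>p. u \<bullet> v + (- (u $ 3 * v $ 2 + u $ 2 * v $ 3)) * p $ 1 + (u $ 2 * v $ 2) * (p $ 1)\<^sup>2)"
      by (auto simp: nil_metric_def inner_vec_def sum_3 algebra_simps power2_eq_square)
    then show ?thesis using k by (simp add: smooth_def)
  qed
  moreover have "bilinear (nil_metric p)" for p
    unfolding bilinear_def
    by (auto intro!: linearI simp: nil_metric_def algebra_simps)
  moreover have "nil_metric p v v > 0" if "v \<noteq> 0" for p v
  proof -
    have "nil_metric p v v = (v $ 1)\<^sup>2 + (v $ 2)\<^sup>2 + (v $ 3 - p $ 1 * v $ 2)\<^sup>2"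
      by (simp add: nil_metric_def power2_eq_square)
    moreover have "v $ 1 \<noteq> 0 \<or> v $ 2 \<noteq> 0 \<or> v $ 3 - p $ 1 * v $ 2 \<noteq> 0"
      using that by (auto simp: vec_eq_iff forall_3)
    ultimately show ?thesis
      by (smt (verit) zero_le_power2 zero_less_power2)
  qed
  ultimately show ?thesis
    by (auto simp: riemannian_metric_def) (auto simp: nil_metric_def mult.commute)
qed

end

theory Submission
  imports Defs
begin

text \<open>With respect to the left-invariant orthonormal frame \<open>\<partial>\<^sub>x\<close>, \<open>\<partial>\<^sub>y + x \<partial>\<^sub>z\<close>, \<open>\<partial>\<^sub>z\<close>, a linear map with
  columns \<open>a, b, c\<close> has energy density \<open>|a|\<^sup>2 + |b + x c|\<^sup>2 + |c|\<^sup>2\<close>. Its gradient is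
  \<open>2 ((b + x c) \<bullet> c) \<partial>\<^sub>x\<close>, so the map is \<open>\<infinity>\<close>-harmonic iff \<open>((b + x c) \<bullet> c) a = 0\<close> for all \<open>x\<close>. The
  coefficient of \<open>x\<close> is \<open>|c|\<^sup>2 a\<close>, hence this says that \<open>a = 0\<close> or \<open>c = 0\<close>.\<close>

lemma frechet_derivative_linear:
  fixes f :: "'a::euclidean_space \<Rightarrow> 'b::real_normed_vector"
  assumes "linear f"
  shows "frechet_derivative f (at p) = f"
  using frechet_derivative_at[OF linear_imp_has_derivative[OF assms]] by simp

text \<open>\<open>matrix_inv\<close> is a choice operator. The witness \<open>B\<close> makes the
  choice a genuine right inverse of \<open>A\<close>, and multiplying on the left by
  \<open>B\<close> then identifies it with \<open>B\<close>.\<close>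

lemma matrix_inv_eqI:
  fixes A B :: "'a::semiring_1^'n^'n"
  assumes "A ** B = mat 1" and "B ** A = mat 1"
  shows "matrix_inv A = B"
proof -
  have "A ** matrix_inv A = mat 1"
    using assms someI[of "\<lambda>C. A ** C = mat 1 \<and> C ** A = mat 1" B]
    by (simp add: matrix_inv_def)
  then show ?thesis
    by (metis assms(2) matrix_mul_assoc matrix_mul_lid matrix_mul_rid)
qed

text \<open>No induction on the order is needed: the derivative in a fixed direction is
  constant.\<close>

lemma smooth_linear:
  fixes f :: "'a::euclidean_space \<Rightarrow> 'b::real_normed_vector"
  assumes "linear f"
  shows "smooth f"
  unfolding smooth_def
proof
  fix k
  show "k_smooth k f"
  proof (cases k)
    case 0
    then show ?thesis
      using assms linear_continuous_on linear_conv_bounded_linear by auto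
  next
    case (Suc m)
    then show ?thesis
      using assms
      by (simp add: linear_imp_differentiable frechet_derivative_linear
          smooth_const[unfolded smooth_def])
  qed
qed

lemma gradient_eqI:
  fixes f :: "'a::euclidean_space \<Rightarrow> real"
  assumes "riemannian_metric g" and f: "(f has_derivative f') (at p)"
    and w: "\<And>v. g p w v = f' v"
  shows "gradient g f p = w"
proof -
  have "\<exists>!w. \<forall>v. g p w v = frechet_derivative f (at p) v"
    using assms(1) f by (intro gradient_unique_existence differentiableI)
  then show ?thesis
    unfolding gradient_def
    using w frechet_derivative_at[OF f] by (intro the1_equality) auto
qed

lemma linear_vec3_expand:
  fixes f :: "real^3 \<Rightarrow> 'b::real_vector"
  assumes "linear f"
  shows "f v = v $ 1 *\<^sub>R f (axis 1 1) + v $ 2 *\<^sub>R f (axis 2 1) + v $ 3 *\<^sub>R f (axis 3 1)"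
proof -
  have "v = v $ 1 *\<^sub>R axis 1 1 + v $ 2 *\<^sub>R axis 2 1 + v $ 3 *\<^sub>R axis 3 1"
    by (simp add: vec_eq_iff forall_3 axis_def)
  then have "f v = f (v $ 1 *\<^sub>R axis 1 1 + v $ 2 *\<^sub>R axis 2 1 + v $ 3 *\<^sub>R axis 3 1)"
    by (rule arg_cong)
  then show ?thesis
    by (simp only: linear_add[OF assms] linear_scale[OF assms])
qed

text \<open>In an orthonormal frame the gradient is the sum of the frame fields weighted by the
  derivatives of \<open>f\<close> along them. The vector is this sum in coordinates, the second
  frame field at \<open>p\<close> being \<open>(0, 1, p $ 1)\<close>.\<close>

lemma gradient_nil:
  assumes f: "(f has_derivative f') (at p)"
  shows "gradient nil_metric f p =
    vector [f' (axis 1 1), f' (axis 2 1) + p $ 1 * f' (axis 3 1),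
      p $ 1 * (f' (axis 2 1) + p $ 1 * f' (axis 3 1)) + f' (axis 3 1)]"
proof (rule gradient_eqI[OF riemannian_metric_nil f])
  fix v
  show "nil_metric p (vector [f' (axis 1 1), f' (axis 2 1) + p $ 1 * f' (axis 3 1),
      p $ 1 * (f' (axis 2 1) + p $ 1 * f' (axis 3 1)) + f' (axis 3 1)]) v = f' v"
    by (subst linear_vec3_expand[OF has_derivative_linear[OF f], of v])
       (simp add: nil_metric_def algebra_simps)
qed

text \<open>A function of x alone is constant along the other two frame fields. Both the squared
  gradient norm of a linear function and the energy density of a linear map have this shape.\<close>

lemma gradient_nil_quadratic:
  fixes h :: "real^3 \<Rightarrow> real"
  assumes "\<And>p. h p = \<alpha> + \<beta> * p $ 1 + \<gamma> * (p $ 1)\<^sup>2"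
  shows "gradient nil_metric h p = (\<beta> + 2 * \<gamma> * p $ 1) *\<^sub>R axis 1 1"
proof -
  have h: "h = (\<lambda>p. \<alpha> + \<beta> * p $ 1 + \<gamma> * (p $ 1)\<^sup>2)"
    using assms by blast
  have "(h has_derivative (\<lambda>v. (\<beta> + 2 * \<gamma> * p $ 1) * v $ 1)) (at p)"
    unfolding h
    by (auto intro!: derivative_eq_intros bounded_linear_imp_has_derivative
        bounded_linear_vec_nth simp: algebra_simps)
  then show ?thesis
    by (subst gradient_nil) (auto simp: vec_eq_iff forall_3 axis_def)
qed

text \<open>\<open>inf_laplacian\<close> is built from gradients instead of a metric trace, so the
  scalar case is computed directly; \<open>A\<close>, \<open>B\<close>, \<open>C\<close> are the
  columns.\<close>

lemma inf_harmonic_function_nil_linear_iff: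
  fixes A B C :: real
  shows "inf_harmonic_function nil_metric (\<lambda>p. A * p $ 1 + B * p $ 2 + C * p $ 3)
    \<longleftrightarrow> A = 0 \<or> C = 0"
proof -
  let ?f = "\<lambda>p::real^3. A * p $ 1 + B * p $ 2 + C * p $ 3"
  have lin: "linear ?f"
    by (rule linearI) (simp_all add: algebra_simps)
  have grad: "gradient nil_metric ?f p =
      vector [A, B + p $ 1 * C, p $ 1 * (B + p $ 1 * C) + C]" for p
    by (subst gradient_nil[OF linear_imp_has_derivative[OF lin]]) (simp add: axis_def)
  have "nil_metric q (gradient nil_metric ?f q) (gradient nil_metric ?f q) =
      (A\<^sup>2 + B\<^sup>2 + C\<^sup>2) + 2 * B * C * q $ 1 + C\<^sup>2 * (q $ 1)\<^sup>2" for q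
    unfolding grad by (simp add: nil_metric_def power2_eq_square algebra_simps)
  note grad_norm = gradient_nil_quadratic[OF this]
  have lap: "inf_laplacian nil_metric ?f p = A * C * (B + p $ 1 * C)" for p
    unfolding inf_laplacian_def grad_norm unfolding grad
    by (simp add: nil_metric_def axis_def power2_eq_square algebra_simps)
  \<comment> \<open>If \<open>C\<close> is nonzero, the first coordinate \<open>(1 - B) / C\<close>
    turns the last factor into 1, which leaves \<open>A * C = 0\<close>.\<close>
  have "A = 0 \<or> C = 0" if "\<forall>p::real^3. A * C * (B + p $ 1 * C) = 0"
    using that[rule_format, of "axis 1 ((1 - B) / C)"] by auto
  then show ?thesis
    by (auto simp: inf_harmonic_function_def lap smooth_linear[OF lin])
qed

lemma metric_trace_nil:
  "metric_trace nil_metric p b =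
     b (axis 1 1) (axis 1 1) + b (axis 2 1) (axis 2 1)
     + p $ 1 * (b (axis 2 1) (axis 3 1) + b (axis 3 1) (axis 2 1))
     + (1 + (p $ 1)\<^sup>2) * b (axis 3 1) (axis 3 1)"
proof -
  let ?G = "gram_matrix nil_metric p"
  \<comment> \<open>This candidate for the inverse is the sum of the outer products of the three
    frame vectors with themselves.\<close>
  let ?H = "vector [vector [1, 0, 0], vector [0, 1, p $ 1],
    vector [0, p $ 1, 1 + (p $ 1)\<^sup>2]] :: real^3^3"
  have "?G ** ?H = mat 1" "?H ** ?G = mat 1"
    by (simp_all add: vec_eq_iff forall_3 matrix_matrix_mult_def sum_3 mat_def gram_matrix_def
        nil_metric_def axis_def power2_eq_square algebra_simps)
  then have "matrix_inv ?G = ?H"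
    by (rule matrix_inv_eqI)
  then show ?thesis
    by (simp add: metric_trace_def sum_3 algebra_simps)
qed

lemma inf_harmonic_map_nil_linear_iff:
  fixes \<phi> :: "real^3 \<Rightarrow> 'b::euclidean_space"
  assumes lin: "linear \<phi>"
  shows "inf_harmonic_map nil_metric standard_metric \<phi>
    \<longleftrightarrow> \<phi> (axis 1 1) = 0 \<or> \<phi> (axis 3 1) = 0"
proof -
  define a b c where "a = \<phi> (axis 1 1)" and "b = \<phi> (axis 2 1)" and "c = \<phi> (axis 3 1)"
  have "energy_density nil_metric standard_metric \<phi> q =
      (a \<bullet> a + b \<bullet> b + c \<bullet> c) + (2 * (b \<bullet> c)) * q $ 1 + (c \<bullet> c) * (q $ 1)\<^sup>2" for q
    by (simp add: energy_density_def metric_trace_nil pullback_metric_def standard_metric_def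
        frechet_derivative_linear[OF lin] a_def b_def c_def inner_commute algebra_simps)
  note grad = gradient_nil_quadratic[OF this]
  have tension: "(1/2) *\<^sub>R frechet_derivative \<phi> (at p)
        (gradient nil_metric (energy_density nil_metric standard_metric \<phi>) p) =
      (b \<bullet> c + (c \<bullet> c) * p $ 1) *\<^sub>R a" for p
    unfolding grad frechet_derivative_linear[OF lin] linear_scale[OF lin] a_def[symmetric]
    by (simp add: algebra_simps)
  \<comment> \<open>As in the scalar case, for nonzero \<open>c\<close> the point is chosen so that
    the coefficient of \<open>a\<close> is 1.\<close>
  have "a = 0 \<or> c = 0" if "\<forall>p::real^3. (b \<bullet> c + (c \<bullet> c) * p $ 1) *\<^sub>R a = 0"
    using that[rule_format, of "axis 1 ((1 - b \<bullet> c) / (c \<bullet> c))"] by auto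
  then show ?thesis
    unfolding inf_harmonic_map_def tension a_def[symmetric] c_def[symmetric]
    by (auto simp: smooth_linear[OF lin])
qed

text \<open>A linear map factors through a surjective linear map iff it vanishes on the kernel, here
  the line spanned by \<open>axis 3 1\<close>.\<close>

lemma linear_factors_proj_xy_iff:
  fixes \<phi> :: "real^3 \<Rightarrow> 'b::real_vector"
  assumes lin: "linear \<phi>"
  shows "(\<exists>L :: real^2 \<Rightarrow> 'b. linear L \<and> \<phi> = L \<circ> proj_xy) \<longleftrightarrow> \<phi> (axis 3 1) = 0"
proof
  assume "\<exists>L :: real^2 \<Rightarrow> 'b. linear L \<and> \<phi> = L \<circ> proj_xy"
  then obtain L :: "real^2 \<Rightarrow> 'b" where "linear L" "\<phi> = L \<circ> proj_xy" by blast
  moreover have "proj_xy (axis 3 1) = 0"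
    by (simp add: proj_xy_def axis_def vec_eq_iff forall_2)
  ultimately show "\<phi> (axis 3 1) = 0"
    by (simp add: linear_0)
next
  assume "\<phi> (axis 3 1) = 0"
  then have "\<phi> = (\<lambda>u. u $ 1 *\<^sub>R \<phi> (axis 1 1) + u $ 2 *\<^sub>R \<phi> (axis 2 1)) \<circ> proj_xy"
    by (intro ext, subst linear_vec3_expand[OF lin]) (simp add: proj_xy_def)
  moreover have "linear (\<lambda>u::real^2. u $ 1 *\<^sub>R \<phi> (axis 1 1) + u $ 2 *\<^sub>R \<phi> (axis 2 1))"
    by (rule linearI) (simp_all add: algebra_simps)
  ultimately show "\<exists>L :: real^2 \<Rightarrow> 'b. linear L \<and> \<phi> = L \<circ> proj_xy"
    by blast
qed

text \<open>The kernel is now the line spanned by \<open>axis 1 1\<close>.\<close>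

lemma linear_factors_proj_yz_iff:
  fixes \<phi> :: "real^3 \<Rightarrow> 'b::real_vector"
  assumes lin: "linear \<phi>"
  shows "(\<exists>L :: real^2 \<Rightarrow> 'b. linear L \<and> \<phi> = L \<circ> proj_yz) \<longleftrightarrow> \<phi> (axis 1 1) = 0"
proof
  assume "\<exists>L :: real^2 \<Rightarrow> 'b. linear L \<and> \<phi> = L \<circ> proj_yz"
  then obtain L :: "real^2 \<Rightarrow> 'b" where "linear L" "\<phi> = L \<circ> proj_yz" by blast
  moreover have "proj_yz (axis 1 1) = 0"
    by (simp add: proj_yz_def axis_def vec_eq_iff forall_2)
  ultimately show "\<phi> (axis 1 1) = 0"
    by (simp add: linear_0)
next
  assume "\<phi> (axis 1 1) = 0"
  then have "\<phi> = (\<lambda>u. u $ 1 *\<^sub>R \<phi> (axis 2 1) + u $ 2 *\<^sub>R \<phi> (axis 3 1)) \<circ> proj_yz"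
    by (intro ext, subst linear_vec3_expand[OF lin]) (simp add: proj_yz_def)
  moreover have "linear (\<lambda>u::real^2. u $ 1 *\<^sub>R \<phi> (axis 2 1) + u $ 2 *\<^sub>R \<phi> (axis 3 1))"
    by (rule linearI) (simp_all add: algebra_simps)
  ultimately show "\<exists>L :: real^2 \<Rightarrow> 'b. linear L \<and> \<phi> = L \<circ> proj_yz"
    by blast
qed

theorem theorem5p1:
  shows "(\<forall>A B C :: real.
            inf_harmonic_function nil_metric (\<lambda>p. A * p $ 1 + B * p $ 2 + C * p $ 3)
              \<longleftrightarrow> A = 0 \<or> C = 0)
       \<and> (CARD('n::finite) \<ge> 2 \<longrightarrow>
            (\<forall>\<phi> :: real^3 \<Rightarrow> real^'n. linear \<phi> \<longrightarrow>
               (inf_harmonic_map nil_metric standard_metric \<phi>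
                  \<longleftrightarrow> (\<exists>L :: real^2 \<Rightarrow> real^'n. linear L \<and> \<phi> = L \<circ> proj_xy)
                    \<or> (\<exists>L :: real^2 \<Rightarrow> real^'n. linear L \<and> \<phi> = L \<circ> proj_yz))))"
  \<comment> \<open>Factoring through \<open>proj_xy\<close> is the second alternative of the
    criterion for maps, hence \<open>disj_commute\<close>.\<close>
  using inf_harmonic_function_nil_linear_iff
  by (simp add: linear_factors_proj_xy_iff linear_factors_proj_yz_iff
      inf_harmonic_map_nil_linear_iff disj_commute)

end
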